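(* Let $M$ and $D$ be sets, let $\mathrm{Inf}: M \to D$ be a function, let $\mathrm{Err}: D \times D \to \mathbb{R}_+$ be a function such that $d_1 = d_2$ implies $\mathrm{Err}(d_1,d_2)=0$, and let $d \in D$. Then there exist a 2-category $\mathbb{T}$, objects $\mu,\delta,\tau$ of $\mathbb{T}$ and a 1-morphism $\iota: \delta \to \mu$ of $\mathbb{T}$ such that: (i) the set of objects of the hom-category $\mathbb{T}(\mu,\tau)$ is $M$ and the set of objects of the hom-category $\mathbb{T}(\delta,\tau)$ is $D$; (ii) the precomposition functor $\mathbb{T}(\iota,\tau): \mathbb{T}(\mu,\tau) \to \mathbb{T}(\delta,\tau)$, $m \mapsto m\iota$, is given on objects by $\mathrm{Inf}$; (iii) for every $m \in M$, $m$ is a global error minimiser with respect to $d$ if and only if $m \cong \mathrm{Lan}_\iota d$, i.e. if and only if a left Kan extension $\mathrm{Lan}_\iota d$ of $d: \delta \to \tau$ along $\iota: \delta \to \mu$ exists in $\mathbb{T}$ and $m$ is isomorphic to it in the category $\mathbb{T}(\mu,\tau)$.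
   Context: $\mathbb{R}_+$ denotes the non-negative real numbers. The data $(M, D, \mathrm{Inf}, \mathrm{Err}, d)$ as in the claim is called a set-theoretic error minimisation problem. An element $x \in M$ is a global error minimiser with respect to $d$ if $\mathrm{Err}(d,\mathrm{Inf}(x)) \le \mathrm{Err}(d,\mathrm{Inf}(m))$ for all $m \in M$. 2-categories are strict: between any two objects $x,y$ there is a hom-category $\mathbb{T}(x,y)$, whose objects are the 1-morphisms $x \to y$ and whose morphisms are the 2-morphisms, and composition is given by functors $\mathbb{T}(y,z)\times\mathbb{T}(x,y)\to\mathbb{T}(x,z)$ that are strictly associative and strictly unital. For a 2-morphism $\alpha$ and a composable 1-morphism $G$, $\alpha\cdot G$ denotes whiskering. Left Kan extension in a 2-category: given 1-morphisms $K: C \to E$ and $G: C \to D'$, a left Kan extension of $K$ along $G$ is a 1-morphism $\mathrm{Lan}_G K: D' \to E$ together with a 2-morphism $\eta: K \Rightarrow (\mathrm{Lan}_G K)G$ such that for any other pair $(H: D' \to E,\ \gamma: K \Rightarrow HG)$ there exists a 2-morphism $\alpha: \mathrm{Lan}_G K \Rightarrow H$ with $\gamma = (\alpha\cdot G)\eta$. *)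

theory Defs
  imports Complex_Main "HOL-Library.FuncSet"
begin

section \<open>Categories and functors\<close>

record ('a, 'b) category =
  Obj :: "'a set"
  Arr :: "'b set"
  Dom :: "'b \<Rightarrow> 'a"
  Cod :: "'b \<Rightarrow> 'a"
  Id :: "'a \<Rightarrow> 'b"
  Comp :: "'b \<Rightarrow> 'b \<Rightarrow> 'b"  \<comment> \<open>\<open>Comp C g f\<close> is \<open>g\<close> after \<open>f\<close>\<close>

definition hom_set :: "('a, 'b) category \<Rightarrow> 'a \<Rightarrow> 'a \<Rightarrow> 'b set" where
  "hom_set C x y = {f \<in> Arr C. Dom C f = x \<and> Cod C f = y}"

locale category =
  fixes C :: "('a, 'b) category"
  assumes Dom_in: "f \<in> Arr C \<Longrightarrow> Dom C f \<in> Obj C"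
    and Cod_in: "f \<in> Arr C \<Longrightarrow> Cod C f \<in> Obj C"
    and Id_in: "x \<in> Obj C \<Longrightarrow> Id C x \<in> hom_set C x x"
    and Comp_in: "f \<in> hom_set C x y \<Longrightarrow> g \<in> hom_set C y z \<Longrightarrow> Comp C g f \<in> hom_set C x z"
    and Comp_Id: "f \<in> hom_set C x y \<Longrightarrow> Comp C f (Id C x) = f"
    and Id_Comp: "f \<in> hom_set C x y \<Longrightarrow> Comp C (Id C y) f = f"
    and Comp_assoc: "f \<in> hom_set C w x \<Longrightarrow> g \<in> hom_set C x y \<Longrightarrow> h \<in> hom_set C y z \<Longrightarrow>
      Comp C h (Comp C g f) = Comp C (Comp C h g) f"

definition isomorphic :: "('a, 'b) category \<Rightarrow> 'a \<Rightarrow> 'a \<Rightarrow> bool" where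
  "isomorphic C x y \<longleftrightarrow> x \<in> Obj C \<and> y \<in> Obj C \<and>
     (\<exists>f \<in> hom_set C x y. \<exists>g \<in> hom_set C y x. Comp C g f = Id C x \<and> Comp C f g = Id C y)"

definition prod_category ::
    "('a, 'b) category \<Rightarrow> ('c, 'd) category \<Rightarrow> ('a \<times> 'c, 'b \<times> 'd) category" where
  "prod_category C D =
    \<lparr> Obj = Obj C \<times> Obj D,
      Arr = Arr C \<times> Arr D,
      Dom = map_prod (Dom C) (Dom D),
      Cod = map_prod (Cod C) (Cod D),
      Id = map_prod (Id C) (Id D),
      Comp = (\<lambda>(g, g') (f, f'). (Comp C g f, Comp D g' f')) \<rparr>"

record ('a, 'b, 'c, 'd) func =
  on_obj :: "'a \<Rightarrow> 'c"
  on_arr :: "'b \<Rightarrow> 'd"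

definition is_functor ::
    "('a, 'b) category \<Rightarrow> ('c, 'd) category \<Rightarrow> ('a, 'b, 'c, 'd) func \<Rightarrow> bool" where
  "is_functor C D F \<longleftrightarrow>
     (\<forall>x \<in> Obj C. on_obj F x \<in> Obj D) \<and>
     (\<forall>x \<in> Obj C. \<forall>y \<in> Obj C. \<forall>f \<in> hom_set C x y.
        on_arr F f \<in> hom_set D (on_obj F x) (on_obj F y)) \<and>
     (\<forall>x \<in> Obj C. on_arr F (Id C x) = Id D (on_obj F x)) \<and>
     (\<forall>x \<in> Obj C. \<forall>y \<in> Obj C. \<forall>z \<in> Obj C. \<forall>f \<in> hom_set C x y. \<forall>g \<in> hom_set C y z.
        on_arr F (Comp C g f) = Comp D (on_arr F g) (on_arr F f))"


section \<open>Strict 2-categories\<close>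

text \<open>
  The hom-categories form a family indexed by pairs of objects. As usual for enriched categories,
  hom-categories over different pairs of objects are not required to be disjoint, so the horizontal
  composition functor is indexed by its three objects.
\<close>

record ('o, 'a, 'b) two_category =
  Ob :: "'o set"
  Hom :: "'o \<Rightarrow> 'o \<Rightarrow> ('a, 'b) category"
  Unit :: "'o \<Rightarrow> 'a"
  HComp :: "'o \<Rightarrow> 'o \<Rightarrow> 'o \<Rightarrow> ('a \<times> 'a, 'b \<times> 'b, 'a, 'b) func"
    \<comment> \<open>\<open>HComp T x y z\<close> is the functor \<open>T(y,z) \<times> T(x,y) \<rightarrow> T(x,z)\<close>\<close>

definition hcomp1 :: "('o, 'a, 'b) two_category \<Rightarrow> 'o \<Rightarrow> 'o \<Rightarrow> 'o \<Rightarrow> 'a \<Rightarrow> 'a \<Rightarrow> 'a" where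
  "hcomp1 T x y z g f = on_obj (HComp T x y z) (g, f)"

definition hcomp2 :: "('o, 'a, 'b) two_category \<Rightarrow> 'o \<Rightarrow> 'o \<Rightarrow> 'o \<Rightarrow> 'b \<Rightarrow> 'b \<Rightarrow> 'b" where
  "hcomp2 T x y z \<beta> \<alpha> = on_arr (HComp T x y z) (\<beta>, \<alpha>)"

locale two_category =
  fixes T :: "('o, 'a, 'b) two_category"
  assumes Hom_category:
      "x \<in> Ob T \<Longrightarrow> y \<in> Ob T \<Longrightarrow> category (Hom T x y)"
    and Unit_in:
      "x \<in> Ob T \<Longrightarrow> Unit T x \<in> Obj (Hom T x x)"
    and HComp_functor:
      "x \<in> Ob T \<Longrightarrow> y \<in> Ob T \<Longrightarrow> z \<in> Ob T \<Longrightarrow>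
       is_functor (prod_category (Hom T y z) (Hom T x y)) (Hom T x z) (HComp T x y z)"
    and assoc1:
      "w \<in> Ob T \<Longrightarrow> x \<in> Ob T \<Longrightarrow> y \<in> Ob T \<Longrightarrow> z \<in> Ob T \<Longrightarrow>
       f \<in> Obj (Hom T w x) \<Longrightarrow> g \<in> Obj (Hom T x y) \<Longrightarrow> h \<in> Obj (Hom T y z) \<Longrightarrow>
       hcomp1 T w y z h (hcomp1 T w x y g f) = hcomp1 T w x z (hcomp1 T x y z h g) f"
    and assoc2:
      "w \<in> Ob T \<Longrightarrow> x \<in> Ob T \<Longrightarrow> y \<in> Ob T \<Longrightarrow> z \<in> Ob T \<Longrightarrow>
       \<alpha> \<in> Arr (Hom T w x) \<Longrightarrow> \<beta> \<in> Arr (Hom T x y) \<Longrightarrow> \<gamma> \<in> Arr (Hom T y z) \<Longrightarrow>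
       hcomp2 T w y z \<gamma> (hcomp2 T w x y \<beta> \<alpha>) = hcomp2 T w x z (hcomp2 T x y z \<gamma> \<beta>) \<alpha>"
    and unit_right1:
      "x \<in> Ob T \<Longrightarrow> y \<in> Ob T \<Longrightarrow> f \<in> Obj (Hom T x y) \<Longrightarrow> hcomp1 T x x y f (Unit T x) = f"
    and unit_left1:
      "x \<in> Ob T \<Longrightarrow> y \<in> Ob T \<Longrightarrow> f \<in> Obj (Hom T x y) \<Longrightarrow> hcomp1 T x y y (Unit T y) f = f"
    and unit_right2:
      "x \<in> Ob T \<Longrightarrow> y \<in> Ob T \<Longrightarrow> \<alpha> \<in> Arr (Hom T x y) \<Longrightarrow>
       hcomp2 T x x y \<alpha> (Id (Hom T x x) (Unit T x)) = \<alpha>"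
    and unit_left2:
      "x \<in> Ob T \<Longrightarrow> y \<in> Ob T \<Longrightarrow> \<alpha> \<in> Arr (Hom T x y) \<Longrightarrow>
       hcomp2 T x y y (Id (Hom T y y) (Unit T y)) \<alpha> = \<alpha>"

definition whisker :: "('o, 'a, 'b) two_category \<Rightarrow> 'o \<Rightarrow> 'o \<Rightarrow> 'o \<Rightarrow> 'b \<Rightarrow> 'a \<Rightarrow> 'b" where
  "whisker T x y z \<alpha> g = hcomp2 T x y z \<alpha> (Id (Hom T x y) g)"

definition precomp ::
    "('o, 'a, 'b) two_category \<Rightarrow> 'o \<Rightarrow> 'o \<Rightarrow> 'o \<Rightarrow> 'a \<Rightarrow> ('a, 'b, 'a, 'b) func" where
  \<comment> \<open>for \<open>g : x \<rightarrow> y\<close>, the functor \<open>T(g,z) : T(y,z) \<rightarrow> T(x,z)\<close>\<close>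
  "precomp T x y z g =
    \<lparr> on_obj = (\<lambda>h. hcomp1 T x y z h g), on_arr = (\<lambda>\<alpha>. whisker T x y z \<alpha> g) \<rparr>"

lemma (in two_category) precomp_functor:
  assumes "x \<in> Ob T" "y \<in> Ob T" "z \<in> Ob T" "g \<in> Obj (Hom T x y)"
  shows "is_functor (Hom T y z) (Hom T x z) (precomp T x y z g)"
proof -
  interpret Cxy: category "Hom T x y" using assms Hom_category by blast
  let ?P = "prod_category (Hom T y z) (Hom T x y)"
  have Idg: "Id (Hom T x y) g \<in> hom_set (Hom T x y) g g"
    using assms(4) by (rule Cxy.Id_in)
  have O: "(h, g) \<in> Obj ?P" if "h \<in> Obj (Hom T y z)" for h
    using that assms(4) by (simp add: prod_category_def)
  have A: "(\<alpha>, Id (Hom T x y) g) \<in> hom_set ?P (h, g) (h', g)"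
    if "\<alpha> \<in> hom_set (Hom T y z) h h'" for \<alpha> h h'
    using that Idg by (auto simp: prod_category_def hom_set_def)
  have I: "Id ?P (h, g) = (Id (Hom T y z) h, Id (Hom T x y) g)" for h
    by (simp add: prod_category_def)
  have C: "Comp ?P (\<beta>, Id (Hom T x y) g) (\<alpha>, Id (Hom T x y) g)
      = (Comp (Hom T y z) \<beta> \<alpha>, Id (Hom T x y) g)" for \<alpha> \<beta>
    using Cxy.Comp_Id[OF Idg] by (simp add: prod_category_def)
  have F: "is_functor ?P (Hom T x z) (HComp T x y z)"
    using assms(1-3) by (rule HComp_functor)
  show ?thesis
    unfolding is_functor_def precomp_def hcomp1_def hcomp2_def whisker_def func.simps
  proof (intro conjI ballI)
    fix h assume "h \<in> Obj (Hom T y z)"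
    then show "on_obj (HComp T x y z) (h, g) \<in> Obj (Hom T x z)"
      using F O unfolding is_functor_def by blast
  next
    fix h h' \<alpha> assume "h \<in> Obj (Hom T y z)" "h' \<in> Obj (Hom T y z)" "\<alpha> \<in> hom_set (Hom T y z) h h'"
    then show "on_arr (HComp T x y z) (\<alpha>, Id (Hom T x y) g)
        \<in> hom_set (Hom T x z) (on_obj (HComp T x y z) (h, g)) (on_obj (HComp T x y z) (h', g))"
      using F O A unfolding is_functor_def by blast
  next
    fix h assume "h \<in> Obj (Hom T y z)"
    then show "on_arr (HComp T x y z) (Id (Hom T y z) h, Id (Hom T x y) g)
        = Id (Hom T x z) (on_obj (HComp T x y z) (h, g))"
      using F O I unfolding is_functor_def by metis
  next
    fix h h' h'' \<alpha> \<beta>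
    assume "h \<in> Obj (Hom T y z)" "h' \<in> Obj (Hom T y z)" "h'' \<in> Obj (Hom T y z)"
      "\<alpha> \<in> hom_set (Hom T y z) h h'" "\<beta> \<in> hom_set (Hom T y z) h' h''"
    then show "on_arr (HComp T x y z) (Comp (Hom T y z) \<beta> \<alpha>, Id (Hom T x y) g)
        = Comp (Hom T x z) (on_arr (HComp T x y z) (\<beta>, Id (Hom T x y) g))
            (on_arr (HComp T x y z) (\<alpha>, Id (Hom T x y) g))"
      using F O A C unfolding is_functor_def by metis
  qed
qed

text \<open>
  \<open>(L, \<eta>)\<close> is a left Kan extension of \<open>K : c \<rightarrow> e\<close> along \<open>G : c \<rightarrow> c'\<close>. The comparison
  2-morphism \<open>\<alpha>\<close> is only required to exist, not to be unique.
\<close>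

definition is_left_Kan_extension ::
    "('o, 'a, 'b) two_category \<Rightarrow> 'o \<Rightarrow> 'o \<Rightarrow> 'o \<Rightarrow> 'a \<Rightarrow> 'a \<Rightarrow> 'a \<Rightarrow> 'b \<Rightarrow> bool" where
  "is_left_Kan_extension T c c' e K G L \<eta> \<longleftrightarrow>
     L \<in> Obj (Hom T c' e) \<and>
     \<eta> \<in> hom_set (Hom T c e) K (hcomp1 T c c' e L G) \<and>
     (\<forall>H \<in> Obj (Hom T c' e). \<forall>\<gamma> \<in> hom_set (Hom T c e) K (hcomp1 T c c' e H G).
        \<exists>\<alpha> \<in> hom_set (Hom T c' e) L H.
          \<gamma> = Comp (Hom T c e) (whisker T c c' e \<alpha> G) \<eta>)"


section \<open>Set-theoretic error minimisation\<close>

definition global_error_minimiser ::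
    "'a set \<Rightarrow> ('a \<Rightarrow> 'b) \<Rightarrow> ('b \<times> 'b \<Rightarrow> real) \<Rightarrow> 'b \<Rightarrow> 'a \<Rightarrow> bool" where
  "global_error_minimiser M Infer Err d x \<longleftrightarrow>
     x \<in> M \<and> (\<forall>m \<in> M. Err (d, Infer x) \<le> Err (d, Infer m))"

end

(*
  Preorder both M and D by the size of the error against d and regard them as thin
  hom-categories out of two further objects \<mu> and \<delta>, with a single non-identity 1-morphism
  \<iota> : \<delta> \<rightarrow> \<mu> acting by Inf. Since Err (d, d) = 0 is the least possible error, d lies below
  everything in D, so every m is a candidate for the extension of d along \<iota>, and the
  universal property only says that the extension lies below every element of M.
*)
theory Submission imports Defs begin

text \<open>An arrow is the pair of its endpoints, so parallel arrows coincide and equations between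
  arrows reduce to equations between endpoints.\<close>

definition preorder_category :: "'a set \<Rightarrow> ('a \<Rightarrow> 'a \<Rightarrow> bool) \<Rightarrow> ('a, 'a \<times> 'a) category" where
  "preorder_category X le =
    \<lparr> Obj = X,
      Arr = {(a, b). a \<in> X \<and> b \<in> X \<and> le a b},
      Dom = fst,
      Cod = snd,
      Id = (\<lambda>a. (a, a)),
      Comp = (\<lambda>g f. (fst f, snd g)) \<rparr>"

lemma preorder_category_simps [simp]:
  "Obj (preorder_category X le) = X"
  "(a, b) \<in> Arr (preorder_category X le) \<longleftrightarrow> a \<in> X \<and> b \<in> X \<and> le a b"
  "Dom (preorder_category X le) = fst"
  "Cod (preorder_category X le) = snd"
  "Id (preorder_category X le) a = (a, a)"
  "Comp (preorder_category X le) g f = (fst f, snd g)"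
  by (simp_all add: preorder_category_def)

lemma mem_hom_set_preorder_category [simp]:
  "f \<in> hom_set (preorder_category X le) a b \<longleftrightarrow> f = (a, b) \<and> a \<in> X \<and> b \<in> X \<and> le a b"
  by (cases f) (auto simp: hom_set_def)

lemma category_preorder_category:
  assumes "reflp_on X le" "transp_on X le"
  shows "category (preorder_category X le)"
proof
  fix f g a b c
  assume "f \<in> hom_set (preorder_category X le) a b" "g \<in> hom_set (preorder_category X le) b c"
  then show "Comp (preorder_category X le) g f \<in> hom_set (preorder_category X le) a c"
    using assms(2) by (auto dest: transp_onD)
qed (use assms(1) in \<open>auto dest: reflp_onD\<close>)

text \<open>Both inverse laws are automatic, since parallel arrows are equal.\<close>

lemma isomorphic_preorder_category:
  "isomorphic (preorder_category X le) a b \<longleftrightarrow> a \<in> X \<and> b \<in> X \<and> le a b \<and> le b a"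
  by (auto simp: isomorphic_def)

text \<open>Thinness leaves no choice for horizontal composition of 2-morphisms: it has to act on
  endpoints by the composition \<open>c\<close> of 1-morphisms.\<close>

definition preorder_two_category ::
    "'o set \<Rightarrow> ('o \<Rightarrow> 'o \<Rightarrow> 'a set) \<Rightarrow> ('o \<Rightarrow> 'o \<Rightarrow> 'a \<Rightarrow> 'a \<Rightarrow> bool) \<Rightarrow> ('o \<Rightarrow> 'a) \<Rightarrow>
     ('o \<Rightarrow> 'o \<Rightarrow> 'o \<Rightarrow> 'a \<Rightarrow> 'a \<Rightarrow> 'a) \<Rightarrow> ('o, 'a, 'a \<times> 'a) two_category" where
  "preorder_two_category Q X le u c =
    \<lparr> Ob = Q,
      Hom = (\<lambda>x y. preorder_category (X x y) (le x y)),
      Unit = u,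
      HComp = (\<lambda>x y z.
        \<lparr> on_obj = (\<lambda>(g, f). c x y z g f),
          on_arr = (\<lambda>(\<beta>, \<alpha>). (c x y z (fst \<beta>) (fst \<alpha>), c x y z (snd \<beta>) (snd \<alpha>))) \<rparr>) \<rparr>"

lemma preorder_two_category_simps [simp]:
  "Ob (preorder_two_category Q X le u c) = Q"
  "Hom (preorder_two_category Q X le u c) x y = preorder_category (X x y) (le x y)"
  "Unit (preorder_two_category Q X le u c) = u"
  "hcomp1 (preorder_two_category Q X le u c) x y z g f = c x y z g f"
  "hcomp2 (preorder_two_category Q X le u c) x y z \<beta> \<alpha> =
     (c x y z (fst \<beta>) (fst \<alpha>), c x y z (snd \<beta>) (snd \<alpha>))"
  "whisker (preorder_two_category Q X le u c) x y z \<beta> f =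
     (c x y z (fst \<beta>) f, c x y z (snd \<beta>) f)"
  by (simp_all add: preorder_two_category_def hcomp1_def hcomp2_def whisker_def)

text \<open>Functoriality of \<open>HComp\<close> reduces to closure and monotonicity of
  \<open>c\<close>; the laws for 2-morphisms are those for 1-morphisms applied to each
  endpoint.\<close>

lemma two_category_preorder_two_category:
  assumes "\<And>x y. x \<in> Q \<Longrightarrow> y \<in> Q \<Longrightarrow> reflp_on (X x y) (le x y)"
    and "\<And>x y. x \<in> Q \<Longrightarrow> y \<in> Q \<Longrightarrow> transp_on (X x y) (le x y)"
    and "\<And>x. x \<in> Q \<Longrightarrow> u x \<in> X x x"
    and comp_in: "\<And>x y z f g. x \<in> Q \<Longrightarrow> y \<in> Q \<Longrightarrow> z \<in> Q \<Longrightarrow>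
      f \<in> X x y \<Longrightarrow> g \<in> X y z \<Longrightarrow> c x y z g f \<in> X x z"
    and comp_mono: "\<And>x y z f f' g g'. x \<in> Q \<Longrightarrow> y \<in> Q \<Longrightarrow> z \<in> Q \<Longrightarrow>
      f \<in> X x y \<Longrightarrow> f' \<in> X x y \<Longrightarrow> le x y f f' \<Longrightarrow>
      g \<in> X y z \<Longrightarrow> g' \<in> X y z \<Longrightarrow> le y z g g' \<Longrightarrow> le x z (c x y z g f) (c x y z g' f')"
    and "\<And>w x y z f g h. w \<in> Q \<Longrightarrow> x \<in> Q \<Longrightarrow> y \<in> Q \<Longrightarrow> z \<in> Q \<Longrightarrow>
      f \<in> X w x \<Longrightarrow> g \<in> X x y \<Longrightarrow> h \<in> X y z \<Longrightarrow>
      c w y z h (c w x y g f) = c w x z (c x y z h g) f"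
    and "\<And>x y f. x \<in> Q \<Longrightarrow> y \<in> Q \<Longrightarrow> f \<in> X x y \<Longrightarrow> c x x y f (u x) = f"
    and "\<And>x y f. x \<in> Q \<Longrightarrow> y \<in> Q \<Longrightarrow> f \<in> X x y \<Longrightarrow> c x y y (u y) f = f"
  shows "two_category (preorder_two_category Q X le u c)"
proof (rule two_category.intro)
  let ?T = "preorder_two_category Q X le u c"
  fix x y z assume "x \<in> Ob ?T" "y \<in> Ob ?T" "z \<in> Ob ?T"
  then show "is_functor (prod_category (Hom ?T y z) (Hom ?T x y)) (Hom ?T x z) (HComp ?T x y z)"
    using comp_in comp_mono
    by (auto simp: is_functor_def prod_category_def hom_set_def preorder_two_category_def)
qed (use assms in \<open>auto simp: category_preorder_category\<close>)

text \<open>The triangle equation compares parallel 2-morphisms and so holds by itself; what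
  survives of the universal property is the existence of a 2-morphism from \<open>L\<close> to
  \<open>H\<close>.\<close>

lemma is_left_Kan_extension_preorder_two_category:
  "is_left_Kan_extension (preorder_two_category Q X le u c) x y z K G L \<eta> \<longleftrightarrow>
     L \<in> X y z \<and> \<eta> = (K, c x y z L G) \<and> K \<in> X x z \<and> c x y z L G \<in> X x z \<and>
     le x z K (c x y z L G) \<and>
     (\<forall>H \<in> X y z. c x y z H G \<in> X x z \<longrightarrow> le x z K (c x y z H G) \<longrightarrow> le y z L H)"
  by (auto simp: is_left_Kan_extension_def)

theorem theorem4p1:
  fixes M D :: "'a set" and Infer :: "'a \<Rightarrow> 'a" and Err :: "'a \<times> 'a \<Rightarrow> real" and d :: 'a
  assumes "Infer \<in> M \<rightarrow> D"
    and "Err \<in> D \<times> D \<rightarrow> {0..}"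
    and "\<And>d1 d2. d1 \<in> D \<Longrightarrow> d2 \<in> D \<Longrightarrow> d1 = d2 \<Longrightarrow> Err (d1, d2) = 0"
    and "d \<in> D"
  shows "\<exists>(T :: (nat, 'a, 'a \<times> 'a) two_category) \<mu> \<delta> \<tau> \<iota>.
    two_category T \<and> \<mu> \<in> Ob T \<and> \<delta> \<in> Ob T \<and> \<tau> \<in> Ob T \<and> \<iota> \<in> Obj (Hom T \<delta> \<mu>) \<and>
    Obj (Hom T \<mu> \<tau>) = M \<and> Obj (Hom T \<delta> \<tau>) = D \<and>
    (\<forall>m \<in> M. on_obj (precomp T \<delta> \<mu> \<tau> \<iota>) m = Infer m) \<and>
    (\<forall>m \<in> M. global_error_minimiser M Infer Err d m \<longleftrightarrow>
      (\<exists>L \<eta>. is_left_Kan_extension T \<delta> \<mu> \<tau> d \<iota> L \<eta> \<and> isomorphic (Hom T \<mu> \<tau>) m L))"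
proof -
  \<comment> \<open>\<open>0, 1, 2\<close> play \<open>\<delta>, \<mu>, \<tau>\<close>, and the element \<open>d\<close> doubles as \<open>\<iota>\<close> and as every identity 1-morphism.\<close>
  define X where "X x y =
    (if x = y then {d} else if x = 0 \<and> y = 1 then {d} else if x = 0 \<and> y = 2 then D
     else if x = 1 \<and> y = 2 then M else {})" for x y :: nat
  \<comment> \<open>The weights only matter on \<open>D\<close> and \<open>M\<close>, the other hom-sets having at most one element.\<close>
  define weight where "weight x m = Err (d, if x = 1 then Infer m else m)" for x :: nat and m
  define le where "le x y m m' \<longleftrightarrow> weight x m \<le> weight x m'" for x y :: nat and m m'
  \<comment> \<open>An endomorphism can only be \<open>d\<close> in its role as identity, so the
    first two branches return the other factor. Only composites along
    \<open>0 \<rightarrow> 1 \<rightarrow> 2\<close> reach the last branch, where \<open>f\<close>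
    is \<iota>.\<close>
  define c where "c x y z g f = (if y = z then f else if x = y then g else Infer g)"
    for x y z :: nat and g f :: 'a
  define T where "T = preorder_two_category {0, 1, 2} X le (\<lambda>_. d) c"
  have Infer_in: "Infer m \<in> D" if "m \<in> M" for m
    using that assms(1) by blast
  have X_02: "X 0 2 = D" and X_12: "X 1 2 = M" and X_01: "X 0 1 = {d}"
    by (simp_all add: X_def)
  have c_012: "c 0 1 2 g f = Infer g" for g f
    by (simp add: c_def)
  have two_cat: "two_category T"
    unfolding T_def
  proof (rule two_category_preorder_two_category)
    fix x y z :: nat and f f' g g'
    assume "f \<in> X x y" "g \<in> X y z"
    then show "c x y z g f \<in> X x z"
      using Infer_in by (auto simp: X_def c_def split: if_splits)
    \<comment> \<open>Along \<open>0 \<rightarrow> 1 \<rightarrow> 2\<close> this holds because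
      \<open>weight 1 m\<close> equals \<open>weight 0 (Infer m)\<close>.\<close>
    assume "f' \<in> X x y" "g' \<in> X y z" "le x y f f'" "le y z g g'"
    with \<open>f \<in> X x y\<close> \<open>g \<in> X y z\<close> show "le x z (c x y z g f) (c x y z g' f')"
      by (auto simp: X_def c_def le_def weight_def split: if_splits)
  next
    \<comment> \<open>Among three composable 1-morphisms at least one is an endomorphism, hence
      \<open>d\<close> acting as an identity.\<close>
    fix w x y z :: nat and f g h
    assume "f \<in> X w x" "g \<in> X x y" "h \<in> X y z"
    then show "c w y z h (c w x y g f) = c w x z (c x y z h g) f"
      by (auto simp: X_def c_def split: if_splits)
  qed (auto simp: le_def reflp_on_def transp_on_def X_def c_def split: if_splits)
  have d_least: "le 0 2 d m" if "m \<in> D" for m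
  proof -
    have "Err (d, d) = 0" "0 \<le> Err (d, m)"
      using assms(2-4) that by auto
    then show ?thesis
      by (simp add: le_def weight_def)
  qed
  have Kan: "is_left_Kan_extension T 0 1 2 d d L \<eta> \<longleftrightarrow>
      \<eta> = (d, Infer L) \<and> global_error_minimiser M Infer Err d L" for L \<eta>
    unfolding T_def is_left_Kan_extension_preorder_two_category X_02 X_12 c_012
    using d_least Infer_in assms(4)
    by (auto simp: global_error_minimiser_def le_def weight_def)
  have iso: "isomorphic (Hom T 1 2) m L \<longleftrightarrow>
      m \<in> M \<and> L \<in> M \<and> Err (d, Infer m) = Err (d, Infer L)" for m L
    unfolding T_def preorder_two_category_simps isomorphic_preorder_category X_12
    by (auto simp: le_def weight_def)
  have "global_error_minimiser M Infer Err d m \<longleftrightarrow>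
      (\<exists>L \<eta>. is_left_Kan_extension T 0 1 2 d d L \<eta> \<and> isomorphic (Hom T 1 2) m L)" for m
    \<comment> \<open>From left to right take \<open>L = m\<close>; conversely, equal errors carry
      minimality from \<open>L\<close> to \<open>m\<close>.\<close>
    unfolding Kan iso by (auto simp: global_error_minimiser_def)
  moreover have "on_obj (precomp T 0 1 2 d) m = Infer m" for m
    by (simp add: precomp_def T_def c_def)
  moreover have "0 \<in> Ob T" "1 \<in> Ob T" "2 \<in> Ob T" "d \<in> Obj (Hom T 0 1)"
    "Obj (Hom T 1 2) = M" "Obj (Hom T 0 2) = D"
    unfolding T_def preorder_two_category_simps preorder_category_simps X_02 X_12 X_01 by simp_all
  ultimately show ?thesis
    using two_cat by blast
qed

end
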